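(* Let $f:\mathbb{R}^d\to\mathbb{R}$ be a differentiable convex function and let $\mathbf{M}\in\mathbb{R}^{d\times d}$ be a symmetric positive definite matrix such that for all $x,h\in\mathbb{R}^d$ $$f(x+h)\le f(x)+\langle\nabla f(x),h\rangle+\tfrac12\langle h,\mathbf{M}h\rangle .$$ Let $\kappa>0$ be a constant such that for all $x,h\in\mathbb{R}^d$ $$f(x)+\langle\nabla f(x),h\rangle+\tfrac{\kappa}{2}\langle h,\mathbf{M}h\rangle\le f(x+h).$$ Let $\alpha>0$ and $\hat S\sim\mathrm{DPP}\big(\tfrac1\alpha\mathbf{M}\big)$. Then $$\sigma(\hat S)=\kappa\,\frac{\lambda_d}{\lambda_d+\alpha},\qquad\text{where }\lambda_d=\lambda_{\min}(\mathbf{M}).$$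
   Context: $[d]=\{1,\dots,d\}$. For $S\subseteq[d]$, $\mathbf{M}_{SS}$ is the principal submatrix of $\mathbf{M}$ with rows and columns indexed by $S$, and $\mathbf{M}_S$ is the $d\times d$ matrix whose $(i,j)$ entry equals $\mathbf{M}_{ij}$ if $i,j\in S$ and $0$ otherwise. $(\cdot)^{+}$ is the Moore-Penrose pseudoinverse. For a random subset $\hat S$ of $[d]$, define $$\sigma(\hat S):=\kappa\cdot\lambda_{\min}\big(\mathbf{M}^{1/2}\,\mathbb{E}[(\mathbf{M}_{\hat S})^{+}]\,\mathbf{M}^{1/2}\big).$$ For a $d\times d$ positive semidefinite matrix $\mathbf{A}$, $\mathrm{DPP}(\mathbf{A})$ is the probability distribution over all subsets $S\subseteq[d]$ (including $\emptyset$) with $\mathbb{P}(S)\propto\det(\mathbf{A}_{SS})$, with the convention $\det(\mathbf{A}_{\emptyset\emptyset})=1$. *)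

theory Defs
  imports "HOL-Probability.Probability"
begin

text \<open>
  Square matrices of order \<open>d\<close> are elements of \<open>real ^ 'n ^ 'n\<close> with \<open>d = CARD('n)\<close>; the
  index set \<open>[d]\<close> is the finite type \<open>'n\<close>, and subsets of \<open>[d]\<close> have type \<open>'n set\<close>.
\<close>

definition psd :: "real ^ 'n ^ 'n \<Rightarrow> bool" where
  "psd A \<longleftrightarrow> transpose A = A \<and> (\<forall>x. 0 \<le> x \<bullet> (A *v x))"

definition pos_def :: "real ^ 'n ^ 'n \<Rightarrow> bool" where
  "pos_def A \<longleftrightarrow> transpose A = A \<and> (\<forall>x. x \<noteq> 0 \<longrightarrow> 0 < x \<bullet> (A *v x))"

definition eigenvalues :: "real ^ 'n ^ 'n \<Rightarrow> real set" where
  "eigenvalues A = {c. \<exists>v. v \<noteq> 0 \<and> A *v v = c *\<^sub>R v}"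

text \<open>Only meant for symmetric \<open>A\<close>, whose set of eigenvalues is finite and nonempty.\<close>

definition lambda_min :: "real ^ 'n ^ 'n \<Rightarrow> real" where
  "lambda_min A = Min (eigenvalues A)"

text \<open>The principal square root \<open>A\<^sup>1\<^sup>/\<^sup>2\<close>; only meant for positive semidefinite \<open>A\<close>.\<close>

definition msqrt :: "real ^ 'n ^ 'n \<Rightarrow> real ^ 'n ^ 'n" where
  "msqrt A = (THE B. psd B \<and> B ** B = A)"

definition is_pinv :: "real ^ 'n ^ 'm \<Rightarrow> real ^ 'm ^ 'n \<Rightarrow> bool" where
  "is_pinv A X \<longleftrightarrow> A ** X ** A = A \<and> X ** A ** X = X \<and>
     transpose (A ** X) = A ** X \<and> transpose (X ** A) = X ** A"

definition pinv :: "real ^ 'n ^ 'm \<Rightarrow> real ^ 'm ^ 'n" where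
  "pinv A = (THE X. is_pinv A X)"

lemma pinv_eqI:
  assumes "is_pinv A X"
  shows "pinv A = X"
proof -
  have "Y = X" if Y: "is_pinv A Y" for Y
  proof -
    note X = assms[unfolded is_pinv_def] and Y = Y[unfolded is_pinv_def]
    have "A ** Y = A ** X"
    proof -
      have "A ** Y = A ** X ** (A ** Y)"
        using X by (simp add: matrix_mul_assoc)
      also have "\<dots> = transpose (A ** X) ** transpose (A ** Y)"
        using X Y by simp
      also have "\<dots> = transpose (A ** Y ** A ** X)"
        by (simp add: matrix_transpose_mul matrix_mul_assoc)
      also have "\<dots> = A ** X"
        using X Y by simp
      finally show ?thesis .
    qed
    moreover have "Y ** A = X ** A"
    proof -
      have "Y ** A = Y ** (A ** X ** A)"
        using X by simp
      also have "\<dots> = (Y ** A) ** (X ** A)"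
        by (simp only: matrix_mul_assoc)
      also have "\<dots> = transpose (Y ** A) ** transpose (X ** A)"
        using X Y by simp
      also have "\<dots> = transpose (X ** (A ** Y ** A))"
        by (simp add: matrix_transpose_mul matrix_mul_assoc)
      also have "\<dots> = X ** A"
        using X Y by simp
      finally show ?thesis .
    qed
    ultimately have "Y ** A ** Y = X ** A ** X"
      by (metis matrix_mul_assoc)
    then show ?thesis
      using X Y by simp
  qed
  then show ?thesis
    unfolding pinv_def using assms by blast
qed

text \<open>\<open>restrict_mat M S\<close> is the full-size matrix \<open>M\<^sub>S\<close>: entries outside \<open>S \<times> S\<close> are set to \<open>0\<close>.\<close>

definition restrict_mat :: "real ^ 'n ^ 'n \<Rightarrow> 'n set \<Rightarrow> real ^ 'n ^ 'n" where
  "restrict_mat M S = (\<chi> i j. if i \<in> S \<and> j \<in> S then M $ i $ j else 0)"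

text \<open>
  \<open>principal_minor A S\<close> is \<open>det A\<^sub>S\<^sub>S\<close>: the library's Leibniz formula for \<open>det\<close>, with the index set
  \<open>UNIV\<close> replaced by \<open>S\<close>.
\<close>

definition principal_minor :: "real ^ 'n ^ 'n \<Rightarrow> 'n set \<Rightarrow> real" where
  "principal_minor A S = (\<Sum>p | p permutes S. of_int (sign p) * (\<Prod>i\<in>S. A $ i $ p i))"

lemma principal_minor_empty: "principal_minor A {} = 1"
  by (simp add: principal_minor_def)

lemma principal_minor_UNIV: "principal_minor A UNIV = det A"
  by (simp add: principal_minor_def det_def)

text \<open>Only meant for positive semidefinite \<open>A\<close>; see \<open>pmf_DPP\<close> below.\<close>

definition DPP :: "real ^ 'n ^ 'n \<Rightarrow> 'n set pmf" where
  "DPP A = embed_pmf (\<lambda>S. principal_minor A S / (\<Sum>T\<in>UNIV. principal_minor A T))"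

lemma principal_minor_eq_det:
  "principal_minor A S =
     det (\<chi> i j. if i \<in> S \<and> j \<in> S then A $ i $ j else if i = j then 1 else 0)"
proof -
  define B where "B = (\<chi> i j. if i \<in> S \<and> j \<in> S then A $ i $ j else if i = j then 1 else 0)"
  have "det B = (\<Sum>p | p permutes S. of_int (sign p) * (\<Prod>i\<in>UNIV. B $ i $ p i))"
    unfolding det_def
  proof (rule sum.mono_neutral_right)
    show "{p. p permutes S} \<subseteq> {p. p permutes UNIV}"
      using permutes_subset by blast
    show "\<forall>p \<in> {p. p permutes UNIV} - {p. p permutes S}.
            of_int (sign p) * (\<Prod>i\<in>UNIV. B $ i $ p i) = 0"
    proof
      fix p assume p: "p \<in> {p. p permutes UNIV} - {p. p permutes S}"
      then obtain i where i: "i \<notin> S" "p i \<noteq> i"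
        by (auto simp: permutes_def)
      then have "B $ i $ p i = 0"
        by (auto simp: B_def)
      then show "of_int (sign p) * (\<Prod>i\<in>UNIV. B $ i $ p i) = 0"
        by (subst prod_zero) auto
    qed
  qed auto
  also have "\<dots> = principal_minor A S"
    unfolding principal_minor_def
  proof (rule sum.cong)
    fix p assume "p \<in> {p. p permutes S}"
    then have p: "p permutes S" by simp
    have "(\<Prod>i\<in>UNIV. B $ i $ p i) = (\<Prod>i\<in>S. B $ i $ p i)"
      by (rule prod.mono_neutral_right) (auto simp: B_def permutes_not_in[OF p])
    also have "\<dots> = (\<Prod>i\<in>S. A $ i $ p i)"
      by (rule prod.cong) (auto simp: B_def permutes_in_image[OF p])
    finally show "of_int (sign p) * (\<Prod>i\<in>UNIV. B $ i $ p i)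
        = of_int (sign p) * (\<Prod>i\<in>S. A $ i $ p i)" by simp
  qed simp
  finally show ?thesis by (simp add: B_def)
qed

lemma psd_det_nonneg:
  fixes A :: "real ^ 'n ^ 'n"
  assumes "psd A"
  shows "0 \<le> det A"
proof (rule ccontr)
  assume neg: "\<not> 0 \<le> det A"
  define g where "g t = det ((1 - t) *\<^sub>R mat 1 + t *\<^sub>R A)" for t
  have cont: "continuous_on {0..1} g"
    unfolding g_def det_def by (intro continuous_intros)
  have "g 1 < 0" "g 0 = 1"
    using neg by (auto simp: g_def)
  then obtain t where t: "0 \<le> t" "t \<le> 1" "g t = 0"
    using IVT2'[of g 1 0 0] cont by force
  then have "t < 1"
    using \<open>g 1 < 0\<close> by (cases "t = 1") auto
  let ?C = "(1 - t) *\<^sub>R mat 1 + t *\<^sub>R A"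
  obtain x where x: "x \<noteq> 0" "?C *v x = 0"
    using t(3) invertible_det_nz[of ?C]
    unfolding g_def invertible_left_inverse matrix_left_invertible_ker by blast
  have "x \<bullet> (?C *v x) = (1 - t) * (x \<bullet> x) + t * (x \<bullet> (A *v x))"
    by (simp add: matrix_vector_mult_add_rdistrib scaleR_matrix_vector_assoc[symmetric]
        inner_add_right)
  moreover have "0 < (1 - t) * (x \<bullet> x)"
    using x \<open>t < 1\<close> by simp
  moreover have "0 \<le> t * (x \<bullet> (A *v x))"
    using assms t by (simp add: psd_def)
  ultimately show False
    using x by simp
qed

lemma psd_principal_minor_nonneg:
  fixes A :: "real ^ 'n ^ 'n"
  assumes "psd A"
  shows "0 \<le> principal_minor A S"
proof -
  let ?B = "\<chi> i j. if i \<in> S \<and> j \<in> S then A $ i $ j else if i = j then 1 else 0"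
  have sym: "A $ i $ j = A $ j $ i" for i j
    using assms by (simp add: psd_def transpose_def vec_eq_iff)
  have "psd ?B"
    unfolding psd_def
  proof
    show "transpose ?B = ?B"
      using sym by (auto simp: transpose_def vec_eq_iff)
    show "\<forall>x. 0 \<le> x \<bullet> (?B *v x)"
    proof
      fix x :: "real ^ 'n"
      define y where "y = (\<chi> i. if i \<in> S then x $ i else 0)"
      have 1: "(A *v y) $ i = (?B *v x) $ i" if "i \<in> S" for i
        unfolding matrix_vector_mult_def y_def using that by (auto intro!: sum.cong)
      have 2: "(?B *v x) $ i = x $ i" if "i \<notin> S" for i
      proof -
        have "(?B *v x) $ i = (\<Sum>j\<in>UNIV. if i = j then x $ j else 0)"
          unfolding matrix_vector_mult_def vec_lambda_beta
          by (rule sum.cong) (use that in auto)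
        then show ?thesis by simp
      qed
      have "y \<bullet> (A *v y) \<le> x \<bullet> (?B *v x)"
        unfolding inner_vec_def by (rule sum_mono) (use 1 2 in \<open>auto simp: y_def\<close>)
      moreover have "0 \<le> y \<bullet> (A *v y)"
        using assms by (simp add: psd_def)
      ultimately show "0 \<le> x \<bullet> (?B *v x)" by simp
    qed
  qed
  then show ?thesis
    using psd_det_nonneg by (simp add: principal_minor_eq_det)
qed

lemma pmf_DPP:
  assumes "psd A"
  shows "pmf (DPP A) S = principal_minor A S / (\<Sum>T\<in>UNIV. principal_minor A T)"
proof -
  let ?Z = "\<Sum>T\<in>UNIV. principal_minor A T"
  have "0 < ?Z"
    using psd_principal_minor_nonneg[OF assms]
    by (intro sum_pos2[of _ "{}"]) (auto simp: principal_minor_empty)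
  then have nonneg: "0 \<le> principal_minor A T / ?Z" for T
    using psd_principal_minor_nonneg[OF assms] by simp
  have "(\<integral>\<^sup>+T. ennreal (principal_minor A T / ?Z) \<partial>count_space UNIV)
      = ennreal (\<Sum>T\<in>UNIV. principal_minor A T / ?Z)"
    using nonneg by (simp add: nn_integral_count_space_finite)
  also have "\<dots> = 1"
    using \<open>0 < ?Z\<close> by (simp flip: sum_divide_distrib)
  finally show ?thesis
    unfolding DPP_def using nonneg by (subst pmf_embed_pmf) auto
qed

text \<open>
  Here \<open>P\<close> is the probability space on which the random subset \<open>S\<close> is defined, so that the Bochner
  integral is the expectation of the matrix-valued random variable \<open>(M\<^sub>S)\<^sup>+\<close>.
\<close>

definition rate_sigma :: "real \<Rightarrow> real ^ 'n ^ 'n \<Rightarrow> 'w measure \<Rightarrow> ('w \<Rightarrow> 'n set) \<Rightarrow> real" where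
  "rate_sigma \<kappa> M P S =
     \<kappa> * lambda_min (msqrt M ** (\<integral>\<omega>. pinv (restrict_mat M (S \<omega>)) \<partial>P) ** msqrt M)"

end

theory Submission
  imports Defs
begin

text \<open>
  The proof rests on the identity \<open>E[(M\<^sub>S)\<^sup>+] = (M + \<alpha> I)\<^sup>-\<^sup>1\<close>. Once it is known, the square root
  \<open>M\<^sup>1\<^sup>/\<^sup>2\<close> commutes with the resolvent \<open>(M + \<alpha> I)\<^sup>-\<^sup>1\<close>, so that
  \<open>M\<^sup>1\<^sup>/\<^sup>2 E[(M\<^sub>S)\<^sup>+] M\<^sup>1\<^sup>/\<^sup>2 = M (M + \<alpha> I)\<^sup>-\<^sup>1\<close>. The eigenvalues of this matrix are the numbers
  \<open>c / (c + \<alpha>)\<close> for the eigenvalues \<open>c\<close> of \<open>M\<close>, and since \<open>c / (c + \<alpha>)\<close> increases with \<open>c > 0\<close>, the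
  smallest one comes from \<open>\<lambda>\<^sub>m\<^sub>i\<^sub>n(M)\<close>.

  For the identity put \<open>A = M / \<alpha>\<close>. Expanding the determinant along the diagonal of the identity
  matrix gives \<open>det (I + A) = \<Sum>\<^sub>S det A\<^sub>S\<^sub>S\<close> for every matrix \<open>A\<close>, which is the normalisation of the
  point process (\<open>det_mat_1_plus\<close>). Apply the same expansion after a vector \<open>u\<close> has been added to
  column \<open>k\<close> of \<open>A\<close>. By Cramer's rule the left side becomes
  \<open>det (I + A) (1 + ((I + A)\<^sup>-\<^sup>1 u)\<^sub>k)\<close>, and each summand on the right becomes
  \<open>det A\<^sub>S\<^sub>S (1 + ((A\<^sub>S)\<^sup>+ u)\<^sub>k)\<close> (\<open>principal_minor_add_to_column\<close>). Subtracting the original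
  expansion and letting \<open>u\<close> and \<open>k\<close> vary yields
  \<open>\<Sum>\<^sub>S det A\<^sub>S\<^sub>S (A\<^sub>S)\<^sup>+ = det (I + A) (I + A)\<^sup>-\<^sup>1\<close> (\<open>sum_principal_minor_pinv\<close>). Division by
  \<open>det (I + A)\<close> turns the left side into the expectation of \<open>(A\<^sub>S)\<^sup>+\<close>.

  To work with the principal square root and the least eigenvalue one needs to know that they exist
  and that the square root is unique. Both follow from the spectral theorem, which is proved here
  by maximising the Rayleigh quotient on the orthogonal complement of a largest orthonormal set of
  eigenvectors (\<open>symmetric_orthonormal_eigenbasis\<close>).
\<close>

section \<open>Symmetric and positive semidefinite matrices\<close>

lemma symmetric_inner:
  fixes A :: "real ^ 'n ^ 'n"
  assumes "transpose A = A"
  shows "(A *v x) \<bullet> y = x \<bullet> (A *v y)"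
  by (metis assms dot_lmul_matrix transpose_matrix_vector)

text \<open>
  This converse of the previous lemma proves the symmetry of matrices that are given by their action
  on vectors.
\<close>

lemma symmetricI:
  fixes A :: "real ^ 'n ^ 'n"
  assumes "\<And>x y. (A *v x) \<bullet> y = x \<bullet> (A *v y)"
  shows "transpose A = A"
proof -
  have "transpose A *v x = A *v x" for x
    by (rule vector_eq_rdot[THEN iffD1]) (metis assms dot_lmul_matrix transpose_matrix_vector)
  then show ?thesis
    by (simp add: matrix_eq)
qed

lemma pos_def_imp_psd: "pos_def A \<Longrightarrow> psd A"
  unfolding pos_def_def psd_def by (metis inner_zero_left less_imp_le order_refl)

lemma pos_def_scaleR:
  assumes "pos_def A" "0 < c"
  shows "pos_def (c *\<^sub>R A)"
  using assms by (simp add: pos_def_def transpose_scalar flip: scaleR_matrix_vector_assoc)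

text \<open>
  A zero of a nonnegative quadratic form is a minimum of it, so the gradient \<open>2 B v\<close> has to vanish
  there. Only directions inside the subspace may be tested, but \<open>B v\<close> itself is one of them. The
  lemma is used for subspaces in the construction of eigenvectors and for the whole space in the
  uniqueness of square roots.
\<close>

lemma form_zero_imp_kernel:
  fixes B :: "real ^ 'n ^ 'n"
  assumes sym: "transpose B = B"
    and W: "subspace W" "\<And>x. x \<in> W \<Longrightarrow> B *v x \<in> W"
    and nonneg: "\<And>x. x \<in> W \<Longrightarrow> 0 \<le> x \<bullet> (B *v x)"
    and v: "v \<in> W" "v \<bullet> (B *v v) = 0"
  shows "B *v v = 0"
proof (rule ccontr)
  assume "B *v v \<noteq> 0"
  define w where "w = B *v v"
  define c where "c = w \<bullet> (B *v w)"
  define q where "q = w \<bullet> w"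
  \<comment> \<open>A step against \<open>w\<close> changes the form by \<open>t\<^sup>2 c - 2 t q\<close>. The shift by 1 in \<open>t\<close> covers \<open>c = 0\<close>.\<close>
  define t where "t = q / (c + 1)"
  have "0 < q"
    using \<open>B *v v \<noteq> 0\<close> by (simp add: q_def w_def)
  have "0 \<le> c"
    unfolding c_def w_def using v W by (intro nonneg)
  have "v - t *\<^sub>R w \<in> W"
    unfolding w_def using v W by (intro subspace_diff subspace_scale)
  then have "0 \<le> (v - t *\<^sub>R w) \<bullet> (B *v (v - t *\<^sub>R w))"
    by (rule nonneg)
  also have "\<dots> = t * t * c - 2 * t * q"
    using v(2) symmetric_inner[OF sym, of v w]
    by (simp add: matrix_vector_mult_diff_distrib matrix_vector_mult_scaleR inner_diff_left
        inner_diff_right c_def q_def inner_commute algebra_simps flip: w_def)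
  also have "\<dots> < 0"
  proof -
    have "t * c < q"
      using \<open>0 < q\<close> \<open>0 \<le> c\<close> by (simp add: t_def field_simps)
    then have "t * c < 2 * q"
      using \<open>0 < q\<close> by simp
    moreover have "0 < t"
      using \<open>0 < q\<close> \<open>0 \<le> c\<close> by (simp add: t_def)
    ultimately show ?thesis
      by (simp add: mult.assoc mult.left_commute)
  qed
  finally show False
    by simp
qed

lemma psd_kernel:
  assumes "psd B" "v \<bullet> (B *v v) = 0"
  shows "B *v v = 0"
  using assms form_zero_imp_kernel[of B UNIV v] by (auto simp: psd_def)

text \<open>
  The quadratic form \<open>x \<bullet> A x\<close> attains its maximum \<open>c\<close> over the unit sphere of \<open>W\<close> at some \<open>v\<close>. Then
  \<open>c I - A\<close> is a nonnegative form on \<open>W\<close> with zero \<open>v\<close>, so \<open>v\<close> lies in its kernel.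
\<close>

lemma symmetric_eigenvector_in_invariant_subspace:
  fixes A :: "real ^ 'n ^ 'n"
  assumes sym: "transpose A = A"
    and W: "subspace W" "\<And>x. x \<in> W \<Longrightarrow> A *v x \<in> W"
    and a: "a \<in> W" "a \<noteq> 0"
  obtains v c where "v \<in> W" "norm v = 1" "A *v v = c *\<^sub>R v"
proof -
  have "compact (W \<inter> sphere 0 1)"
    using closed_Int_compact closed_subspace W(1) compact_sphere by blast
  moreover have "a /\<^sub>R norm a \<in> W \<inter> sphere 0 1"
    using a W(1) by (simp add: subspace_scale)
  moreover have "continuous_on (W \<inter> sphere 0 1) (\<lambda>x. x \<bullet> (A *v x))"
    by (intro continuous_intros linear_continuous_on linear_conv_bounded_linear[THEN iffD1]
        matrix_vector_mul_linear)
  ultimately have "\<exists>v\<in>W \<inter> sphere 0 1. \<forall>x\<in>W \<inter> sphere 0 1. x \<bullet> (A *v x) \<le> v \<bullet> (A *v v)"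
    by (intro continuous_attains_sup) blast+
  then obtain v where v: "v \<in> W" "norm v = 1"
    and max: "\<And>x. x \<in> W \<Longrightarrow> norm x = 1 \<Longrightarrow> x \<bullet> (A *v x) \<le> v \<bullet> (A *v v)"
    by auto
  define c where "c = v \<bullet> (A *v v)"
  let ?B = "c *\<^sub>R mat 1 - A"
  have B: "?B *v x = c *\<^sub>R x - A *v x" for x
    by (simp add: matrix_vector_mult_diff_rdistrib flip: scaleR_matrix_vector_assoc)
  have "?B *v v = 0"
  proof (rule form_zero_imp_kernel[where W = W])
    show "transpose ?B = ?B"
      by (rule symmetricI) (simp add: B inner_diff symmetric_inner[OF sym])
    show "?B *v x \<in> W" if "x \<in> W" for x
      unfolding B using W that by (simp add: subspace_diff subspace_scale)
    show "0 \<le> x \<bullet> (?B *v x)" if "x \<in> W" for x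
    proof (cases "x = 0")
      case False
      have "(x /\<^sub>R norm x) \<bullet> (A *v (x /\<^sub>R norm x)) \<le> c"
        unfolding c_def using W(1) that False by (intro max) (auto simp: subspace_scale)
      then have "x \<bullet> (A *v x) \<le> c * (x \<bullet> x)"
        using False
        by (simp add: matrix_vector_mult_scaleR dot_square_norm field_simps power2_eq_square)
      then show ?thesis
        by (simp add: B inner_diff_right)
    qed simp
    show "v \<bullet> (?B *v v) = 0"
      using v by (simp add: B inner_diff_right dot_square_norm flip: c_def)
  qed (use W v in auto)
  then have "A *v v = c *\<^sub>R v"
    by (simp add: B)
  then show thesis
    using that v by blast
qed

text \<open>
  Take an orthonormal set of eigenvectors with the largest possible number of elements. Symmetry
  makes its orthogonal complement invariant, so a nonzero complement would contain a further
  eigenvector. The eigenvalue of a unit eigenvector \<open>v\<close> is written as \<open>v \<bullet> A v\<close>, which avoids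
  carrying a separate function of eigenvalues.
\<close>

lemma symmetric_orthonormal_eigenbasis:
  fixes A :: "real ^ 'n ^ 'n"
  assumes sym: "transpose A = A"
  obtains E where "finite E" "pairwise orthogonal E" "\<And>v. v \<in> E \<Longrightarrow> norm v = 1"
    "\<And>v. v \<in> E \<Longrightarrow> A *v v = (v \<bullet> (A *v v)) *\<^sub>R v" "span E = UNIV"
proof -
  define good where "good E \<longleftrightarrow> pairwise orthogonal E \<and>
    (\<forall>v\<in>E. norm v = 1 \<and> (\<exists>c. A *v v = c *\<^sub>R v))" for E
  have bound: "finite E \<and> card E \<le> DIM(real ^ 'n)" if "good E" for E
  proof -
    have "0 \<notin> E"
      using that by (auto simp: good_def)
    then show ?thesis
      using that independent_bound pairwise_orthogonal_independent good_def by blast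
  qed
  have "good {}"
    by (simp add: good_def)
  then obtain E where E: "good E" and max: "\<And>F. good F \<Longrightarrow> card F \<le> card E"
    using Lattices_Big.ex_has_greatest_nat[of good "{}" card "Suc DIM(real ^ 'n)"] bound
    by (metis less_Suc_eq_le)
  have "span E = UNIV"
  proof (rule ccontr)
    assume "span E \<noteq> UNIV"
    then obtain a where a: "a \<noteq> 0" "\<And>x. x \<in> span E \<Longrightarrow> a \<bullet> x = 0"
      using span_not_UNIV_orthogonal by blast
    define W where "W = {x. \<forall>v\<in>E. orthogonal v x}"
    have "subspace W"
      unfolding W_def by (rule subspace_orthogonal_to_vectors)
    moreover have "A *v x \<in> W" if x: "x \<in> W" for x
      unfolding W_def
    proof safe
      fix v assume "v \<in> E"
      then obtain c where "A *v v = c *\<^sub>R v"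
        using E by (auto simp: good_def)
      then have "v \<bullet> (A *v x) = c * (v \<bullet> x)"
        by (simp flip: symmetric_inner[OF sym])
      then show "orthogonal v (A *v x)"
        using x \<open>v \<in> E\<close> by (simp add: W_def orthogonal_def)
    qed
    moreover have "a \<in> W"
      using a by (auto simp: W_def orthogonal_def inner_commute span_base)
    ultimately obtain v c where v: "v \<in> W" "norm v = 1" "A *v v = c *\<^sub>R v"
      using symmetric_eigenvector_in_invariant_subspace[OF sym] a(1) by metis
    have "v \<notin> E"
      using v by (force simp: W_def orthogonal_def dot_square_norm)
    have "good (insert v E)"
      using E v by (auto simp: good_def W_def pairwise_insert orthogonal_commute)
    then have "card (insert v E) \<le> card E"
      by (rule max)
    then show False
      using \<open>v \<notin> E\<close> bound[OF E] by simp
  qed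
  moreover have "A *v v = (v \<bullet> (A *v v)) *\<^sub>R v" if "v \<in> E" for v
    using E that by (auto simp: good_def dot_square_norm)
  ultimately show thesis
    using that[of E] E bound[OF E] by (auto simp: good_def)
qed

text \<open>
  The minimum in \<open>lambda_min\<close> is meaningful: an eigenvector is not orthogonal to all
  elements of an eigenbasis, and by symmetry it shares its eigenvalue with any basis vector to which
  it is not orthogonal.
\<close>

lemma symmetric_eigenvalues:
  fixes A :: "real ^ 'n ^ 'n"
  assumes "transpose A = A"
  shows "finite (eigenvalues A)" and "eigenvalues A \<noteq> {}"
proof -
  obtain E where E: "finite E" "\<And>v. v \<in> E \<Longrightarrow> norm v = 1"
    "\<And>v. v \<in> E \<Longrightarrow> A *v v = (v \<bullet> (A *v v)) *\<^sub>R v" "span E = UNIV"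
    using symmetric_orthonormal_eigenbasis[OF assms] by metis
  have "eigenvalues A \<subseteq> (\<lambda>v. v \<bullet> (A *v v)) ` E"
  proof
    fix c assume "c \<in> eigenvalues A"
    then obtain x where x: "x \<noteq> 0" "A *v x = c *\<^sub>R x"
      by (auto simp: eigenvalues_def)
    have "\<exists>v\<in>E. x \<bullet> v \<noteq> 0"
    proof (rule ccontr)
      assume "\<not> (\<exists>v\<in>E. x \<bullet> v \<noteq> 0)"
      then have "orthogonal x x"
        using E(4) by (intro orthogonal_to_span[of x E]) (auto simp: orthogonal_def)
      then show False
        using x by (simp add: orthogonal_def)
    qed
    then obtain v where v: "v \<in> E" "x \<bullet> v \<noteq> 0" by blast
    have "c * (x \<bullet> v) = (v \<bullet> (A *v v)) * (x \<bullet> v)"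
      using symmetric_inner[OF assms, of x v] by (subst (asm) E(3)[OF v(1)]) (simp add: x(2))
    then show "c \<in> (\<lambda>v. v \<bullet> (A *v v)) ` E"
      using v by auto
  qed
  then show "finite (eigenvalues A)"
    using E(1) finite_surj by blast
  have "axis undefined 1 \<noteq> (0 :: real ^ 'n)"
    by (simp add: axis_eq_0_iff)
  then show "eigenvalues A \<noteq> {}"
    using symmetric_eigenvector_in_invariant_subspace[OF assms, of UNIV "axis undefined 1"]
    unfolding eigenvalues_def
    by (metis (mono_tags, lifting) UNIV_I empty_iff mem_Collect_eq norm_zero subspace_UNIV
        zero_neq_one)
qed

lemma pos_def_eigenvalue_pos:
  assumes "pos_def M" "c \<in> eigenvalues M"
  shows "0 < c"
proof -
  obtain v where v: "v \<noteq> 0" "M *v v = c *\<^sub>R v"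
    using assms(2) by (auto simp: eigenvalues_def)
  then have "0 < c * (v \<bullet> v)"
    using assms(1) by (metis inner_scaleR_right pos_def_def)
  then show ?thesis
    using v(1) by (metis inner_gt_zero_iff zero_less_mult_pos2)
qed

section \<open>The principal square root\<close>

lemma matrix_eq_on_span:
  fixes A B :: "real ^ 'n ^ 'm"
  assumes "span E = UNIV" "\<And>v. v \<in> E \<Longrightarrow> A *v v = B *v v"
  shows "A = B"
  using linear_eq_on[of "(*v) A" "(*v) B" _ E] assms by (auto simp: matrix_eq)

text \<open>
  On an orthonormal eigenbasis, replace each eigenvalue by its square root.
\<close>

lemma psd_sqrt_exists:
  fixes M :: "real ^ 'n ^ 'n"
  assumes "psd M"
  obtains B where "psd B" "B ** B = M"
proof -
  obtain E where E: "finite E" "pairwise orthogonal E" "\<And>v. v \<in> E \<Longrightarrow> norm v = 1"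
    "\<And>v. v \<in> E \<Longrightarrow> M *v v = (v \<bullet> (M *v v)) *\<^sub>R v" "span E = UNIV"
    using symmetric_orthonormal_eigenbasis[of M] assms by (auto simp: psd_def)
  define r where "r v = sqrt (v \<bullet> (M *v v))" for v
  define g where "g x = (\<Sum>v\<in>E. (r v * (v \<bullet> x)) *\<^sub>R v)" for x
  define B where "B = matrix g"
  have "linear g"
    unfolding g_def
    by (rule linearI) (auto simp: inner_add_right algebra_simps sum.distrib scaleR_sum_right)
  then have B: "B *v x = g x" for x
    unfolding B_def by (simp add: matrix_vector_mul(1))
  have inner_g: "x \<bullet> g y = (\<Sum>v\<in>E. r v * (v \<bullet> x) * (v \<bullet> y))" for x y
    unfolding g_def by (simp add: inner_sum_right inner_commute mult_ac)
  have "psd B"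
    unfolding psd_def
  proof (intro conjI allI)
    show "transpose B = B"
      by (rule symmetricI) (simp add: B inner_g inner_commute[of "g _"] mult_ac)
    show "0 \<le> x \<bullet> (B *v x)" for x
      using assms by (auto simp: B inner_g mult.assoc r_def psd_def intro!: sum_nonneg)
  qed
  moreover have "B ** B = M"
  proof (rule matrix_eq_on_span[OF E(5)])
    fix w assume w: "w \<in> E"
    have "g w = (\<Sum>v\<in>E. if v = w then r w *\<^sub>R w else 0)"
      unfolding g_def
    proof (rule sum.cong)
      fix v assume v: "v \<in> E"
      show "(r v * (v \<bullet> w)) *\<^sub>R v = (if v = w then r w *\<^sub>R w else 0)"
        using E(2,3) v w by (auto simp: pairwise_def orthogonal_def dot_square_norm)
    qed simp
    then have "B *v w = r w *\<^sub>R w"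
      using E(1) w by (simp add: B)
    then have "(B ** B) *v w = (r w * r w) *\<^sub>R w"
      by (simp add: matrix_vector_mult_scaleR flip: matrix_vector_mul_assoc)
    also have "r w * r w = w \<bullet> (M *v w)"
      using assms by (simp add: r_def psd_def)
    finally show "(B ** B) *v w = M *v w"
      using E(4)[OF w] by simp
  qed
  ultimately show thesis
    using that by blast
qed

text \<open>
  The two roots are not known to commute, so a common eigenbasis is not at hand. Instead consider an
  eigenvector \<open>v\<close> of the symmetric matrix \<open>D = B - C\<close> with eigenvalue \<open>c\<close>. From \<open>B\<^sup>2 = C\<^sup>2\<close> follows
  \<open>D B + C D = 0\<close>, and evaluating this form at \<open>v\<close> gives \<open>c (v \<bullet> B v + v \<bullet> C v) = 0\<close>. If \<open>c \<noteq> 0\<close>,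
  both summands vanish and \<open>v\<close> lies in the kernels of \<open>B\<close> and \<open>C\<close>. Hence \<open>D\<close> vanishes on an eigenbasis.
\<close>

lemma psd_sqrt_unique:
  fixes B C :: "real ^ 'n ^ 'n"
  assumes "psd B" "psd C" "B ** B = C ** C"
  shows "B = C"
proof -
  have sym: "transpose B = B" "transpose C = C"
    using assms by (auto simp: psd_def)
  have D: "(B - C) *v x = B *v x - C *v x" for x
    by (simp add: matrix_vector_mult_diff_rdistrib)
  have "transpose (B - C) = B - C"
    by (rule symmetricI) (simp add: D inner_diff symmetric_inner[OF sym(1)] symmetric_inner[OF sym(2)])
  then obtain E where E: "span E = UNIV" "\<And>v. v \<in> E \<Longrightarrow> \<exists>c. (B - C) *v v = c *\<^sub>R v"
    by (metis symmetric_orthonormal_eigenbasis)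
  show ?thesis
  proof (rule matrix_eq_on_span[OF E(1)])
    fix v assume "v \<in> E"
    then obtain c where c: "B *v v - C *v v = c *\<^sub>R v"
      using E(2) D by auto
    \<comment> \<open>The value of \<open>D B + C D\<close> at \<open>v\<close>, computed with \<open>D v = c v\<close> and with \<open>D = B - C\<close>.\<close>
    have "c * (v \<bullet> (B *v v) + v \<bullet> (C *v v))
        = (B *v v - C *v v) \<bullet> (B *v v) + (C *v v) \<bullet> (B *v v - C *v v)"
      by (simp add: c inner_commute algebra_simps)
    also have "\<dots> = (B *v v) \<bullet> (B *v v) - (C *v v) \<bullet> (C *v v)"
      by (simp add: inner_diff)
    also have "\<dots> = v \<bullet> ((B ** B) *v v) - v \<bullet> ((C ** C) *v v)"
      by (simp add: symmetric_inner[OF sym(1)] symmetric_inner[OF sym(2)] matrix_vector_mul_assoc)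
    finally have "c = 0 \<or> v \<bullet> (B *v v) + v \<bullet> (C *v v) = 0"
      using assms(3) by simp
    then show "B *v v = C *v v"
    proof
      assume "v \<bullet> (B *v v) + v \<bullet> (C *v v) = 0"
      moreover have "0 \<le> v \<bullet> (B *v v)" "0 \<le> v \<bullet> (C *v v)"
        using assms by (auto simp: psd_def)
      ultimately show ?thesis
        using psd_kernel assms(1,2) by (metis add_nonneg_eq_0_iff)
    qed (use c in simp)
  qed
qed

lemma msqrt:
  assumes "psd M"
  shows "psd (msqrt M)" "msqrt M ** msqrt M = M"
proof -
  have "\<exists>!B. psd B \<and> B ** B = M"
    using psd_sqrt_exists[OF assms] psd_sqrt_unique by metis
  then have "psd (msqrt M) \<and> msqrt M ** msqrt M = M"
    unfolding msqrt_def by (rule theI')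
  then show "psd (msqrt M)" "msqrt M ** msqrt M = M"
    by auto
qed

section \<open>Principal minors\<close>

text \<open>
  In the Leibniz formula, multiply out \<open>\<Prod>\<^sub>i (I $ i $ p i + A $ i $ p i)\<close> and let \<open>S\<close> be the set of indices
  at which the factor from \<open>A\<close> is chosen. The factors from \<open>I\<close> survive exactly when \<open>p\<close> fixes the
  complement of \<open>S\<close>, that is, when \<open>p\<close> is a permutation of \<open>S\<close>.
\<close>

lemma det_mat_1_plus:
  fixes A :: "real ^ 'n ^ 'n"
  shows "det (mat 1 + A) = (\<Sum>S\<in>UNIV. principal_minor A S)"
proof -
  have "det (mat 1 + A) = (\<Sum>p | p permutes UNIV. \<Sum>S\<in>UNIV.
      of_int (sign p) * ((\<Prod>i\<in>S. A $ i $ p i) * (\<Prod>i\<in>- S. mat 1 $ i $ p i)))"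
    unfolding det_def
    by (simp add: prod_add add.commute[of "mat 1 $ _ $ _"] sum_distrib_left Compl_eq_Diff_UNIV)
  also have "\<dots> = (\<Sum>S\<in>UNIV. \<Sum>p | p permutes UNIV.
      of_int (sign p) * ((\<Prod>i\<in>S. A $ i $ p i) * (\<Prod>i\<in>- S. mat 1 $ i $ p i)))"
    by (rule sum.swap)
  also have "\<dots> = (\<Sum>S\<in>UNIV. principal_minor A S)"
  proof (rule sum.cong)
    fix S :: "'n set"
    have "(\<Prod>i\<in>- S. mat 1 $ i $ p i) = (if p permutes S then 1 else 0 :: real)"
      if p: "p permutes UNIV" for p
    proof (cases "p permutes S")
      case True
      then show ?thesis
        by (auto simp: mat_def permutes_not_in intro!: prod.neutral)
    next
      case False
      then obtain i where "i \<notin> S" "p i \<noteq> i"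
        using permutes_superset[OF p, of S] False by auto
      then have "(\<Prod>i\<in>- S. mat 1 $ i $ p i) = (0 :: real)"
        by (intro prod_zero bexI[of _ i]) (simp_all add: mat_def)
      then show ?thesis
        using False by simp
    qed
    then have "(\<Sum>p | p permutes UNIV.
        of_int (sign p) * ((\<Prod>i\<in>S. A $ i $ p i) * (\<Prod>i\<in>- S. mat 1 $ i $ p i)))
      = (\<Sum>p | p permutes UNIV.
          if p permutes S then of_int (sign p) * (\<Prod>i\<in>S. A $ i $ p i) else 0)"
      by (intro sum.cong) auto
    also have "\<dots> = (\<Sum>p \<in> {p \<in> {p. p permutes UNIV}. p permutes S}.
        of_int (sign p) * (\<Prod>i\<in>S. A $ i $ p i))"
      by (rule sum.inter_filter[symmetric]) (simp add: finite_permutations)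
    also have "{p \<in> {p. p permutes UNIV}. p permutes S} = {p. p permutes S}"
      using permutes_subset[of _ S UNIV] by blast
    finally show "(\<Sum>p | p permutes UNIV.
        of_int (sign p) * ((\<Prod>i\<in>S. A $ i $ p i) * (\<Prod>i\<in>- S. mat 1 $ i $ p i)))
      = principal_minor A S"
      by (simp add: principal_minor_def)
  qed simp
  finally show ?thesis .
qed

text \<open>
  The rank-one perturbation \<open>A + u e\<^sub>k\<^sup>T\<close>.
\<close>

definition add_to_column :: "real ^ 'n ^ 'n \<Rightarrow> 'n \<Rightarrow> real ^ 'n \<Rightarrow> real ^ 'n ^ 'n" where
  "add_to_column A k u = (\<chi> i j. A $ i $ j + (if j = k then u $ i else 0))"

text \<open>
  Column \<open>k\<close> of the perturbed matrix is \<open>A (e\<^sub>k + X u)\<close>, so Cramer's rule reads off coordinate \<open>k\<close> of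
  \<open>e\<^sub>k + X u\<close>. This is the matrix determinant lemma for \<open>A + u e\<^sub>k\<^sup>T\<close>.
\<close>

lemma det_add_to_column:
  fixes A :: "real ^ 'n ^ 'n"
  assumes "A ** X = mat 1"
  shows "det (add_to_column A k u) = det A * (1 + (X *v u) $ k)"
proof -
  let ?x = "axis k 1 + X *v u"
  have "A *v ?x = column k A + u"
    using assms by (simp add: matrix_vector_right_distrib matrix_vector_mult_basis
        matrix_vector_mul_assoc)
  then have "add_to_column A k u = (\<chi> i j. if j = k then (A *v ?x) $ i else A $ i $ j)"
    by (simp add: add_to_column_def vec_eq_iff column_def)
  then show ?thesis
    using cramer_lemma[of k A ?x] by (simp add: axis_def mult.commute)
qed

section \<open>The pseudoinverse of a restricted matrix\<close>

definition coord_proj :: "'n set \<Rightarrow> real ^ 'n ^ 'n" where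
  "coord_proj S = (\<chi> i j. if i = j \<and> i \<in> S then 1 else 0)"

text \<open>
  The principal submatrix \<open>A\<^sub>S\<^sub>S\<close>, completed to full size by an identity block. It has the same
  determinant as \<open>A\<^sub>S\<^sub>S\<close> and is invertible together with it, which gives access to the inverse of a
  submatrix without changing the index type.
\<close>

definition unit_padding :: "real ^ 'n ^ 'n \<Rightarrow> 'n set \<Rightarrow> real ^ 'n ^ 'n" where
  "unit_padding A S = (\<chi> i j. if i \<in> S \<and> j \<in> S then A $ i $ j else if i = j then 1 else 0)"

lemma coord_proj_mult_left: "(coord_proj S ** A) $ i $ j = (if i \<in> S then A $ i $ j else 0)"
proof -
  have "(coord_proj S ** A) $ i $ j
      = (\<Sum>k\<in>UNIV. if i = k then (if i \<in> S then A $ i $ j else 0) else 0)"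
    unfolding matrix_matrix_mult_def coord_proj_def vec_lambda_beta by (rule sum.cong) auto
  then show ?thesis by simp
qed

lemma coord_proj_mult_right: "(A ** coord_proj S) $ i $ j = (if j \<in> S then A $ i $ j else 0)"
proof -
  have "(A ** coord_proj S) $ i $ j
      = (\<Sum>k\<in>UNIV. if k = j then (if j \<in> S then A $ i $ j else 0) else 0)"
    unfolding matrix_matrix_mult_def coord_proj_def vec_lambda_beta by (rule sum.cong) auto
  then show ?thesis by simp
qed

lemma coord_proj_mult_vec: "(coord_proj S *v x) $ i = (if i \<in> S then x $ i else 0)"
proof -
  have "(coord_proj S *v x) $ i
      = (\<Sum>k\<in>UNIV. if i = k then (if i \<in> S then x $ i else 0) else 0)"
    unfolding matrix_vector_mult_def coord_proj_def vec_lambda_beta by (rule sum.cong) auto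
  then show ?thesis by simp
qed

lemma transpose_coord_proj: "transpose (coord_proj S) = coord_proj S"
  by (auto simp: transpose_def coord_proj_def vec_eq_iff)

lemma coord_proj_idem: "coord_proj S ** coord_proj S = coord_proj S"
  by (auto simp: vec_eq_iff coord_proj_mult_left) (auto simp: coord_proj_def)

lemma restrict_mat_eq_compression:
  "restrict_mat A S = coord_proj S ** A ** coord_proj S"
  by (simp add: vec_eq_iff coord_proj_mult_left coord_proj_mult_right restrict_mat_def)

lemma coord_proj_unit_padding:
  shows "coord_proj S ** unit_padding A S = restrict_mat A S"
    and "unit_padding A S ** coord_proj S = restrict_mat A S"
  by (auto simp: vec_eq_iff coord_proj_mult_left coord_proj_mult_right restrict_mat_def
      unit_padding_def)

lemma unit_padding_eq: "unit_padding A S = restrict_mat A S + (mat 1 - coord_proj S)"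
  by (auto simp: vec_eq_iff unit_padding_def restrict_mat_def coord_proj_def mat_def)

text \<open>
  A vector \<open>x\<close> in the kernel satisfies \<open>J x \<bullet> A J x = 0\<close> for the coordinate projection \<open>J\<close>, hence
  \<open>J x = 0\<close>. On the other coordinates the matrix is the identity, so \<open>x = 0\<close>.
\<close>

lemma unit_padding_inverse:
  fixes A :: "real ^ 'n ^ 'n"
  assumes "pos_def A"
  obtains X where "unit_padding A S ** X = mat 1" "X ** unit_padding A S = mat 1"
proof -
  let ?J = "coord_proj S" and ?B = "unit_padding A S"
  have "x = 0" if "?B *v x = 0" for x
  proof -
    have restrict: "restrict_mat A S *v x = 0"
      using that by (simp add: matrix_vector_mult_0_right
          flip: coord_proj_unit_padding(1) matrix_vector_mul_assoc)
    have "(?J *v x) \<bullet> (A *v (?J *v x)) = x \<bullet> (restrict_mat A S *v x)"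
      by (simp add: restrict_mat_eq_compression symmetric_inner[OF transpose_coord_proj]
          matrix_vector_mul_assoc matrix_mul_assoc)
    then have "?J *v x = 0"
      using assms restrict unfolding pos_def_def by force
    then show "x = 0"
      using that restrict
      by (simp add: unit_padding_eq matrix_vector_mult_add_rdistrib matrix_vector_mult_diff_rdistrib)
  qed
  then show thesis
    using that matrix_left_invertible_ker matrix_left_right_inverse by metis
qed

text \<open>
  The restricted matrix is the padded matrix \<open>B\<close> with its identity block removed: it equals \<open>J B\<close>
  and \<open>B J\<close> for the coordinate projection \<open>J\<close>. Its pseudoinverse is the inverse of \<open>B\<close> with the
  identity block removed, and both products of the two matrices are the symmetric idempotent \<open>J\<close>.
\<close>

lemma pinv_restrict_mat:
  fixes A :: "real ^ 'n ^ 'n"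
  assumes X: "unit_padding A S ** X = mat 1" "X ** unit_padding A S = mat 1"
  shows "is_pinv (restrict_mat A S) (X ** coord_proj S)"
    and "X ** coord_proj S = coord_proj S ** X"
proof -
  let ?J = "coord_proj S" and ?B = "unit_padding A S" and ?R = "restrict_mat A S"
  have RX: "?R ** X = ?J"
    by (metis coord_proj_unit_padding(1) X(1) matrix_mul_assoc matrix_mul_rid)
  have XR: "X ** ?R = ?J"
    by (metis coord_proj_unit_padding(2) X(2) matrix_mul_assoc matrix_mul_lid)
  have JR: "?J ** ?R = ?R" and RJ: "?R ** ?J = ?R"
    by (metis coord_proj_idem restrict_mat_eq_compression matrix_mul_assoc)+
  show XJ: "X ** ?J = ?J ** X"
    by (metis RX XR matrix_mul_assoc)
  have 1: "?R ** (X ** ?J) = ?J"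
    by (simp add: matrix_mul_assoc RX coord_proj_idem)
  have 2: "X ** ?J ** ?R = ?J"
    by (simp add: JR XR flip: matrix_mul_assoc)
  have 3: "?J ** (X ** ?J) = X ** ?J"
    by (metis XJ coord_proj_idem matrix_mul_assoc)
  show "is_pinv ?R (X ** ?J)"
    unfolding is_pinv_def by (simp only: 1 2 3 JR transpose_coord_proj)
qed

lemma is_pinv_scaleR:
  assumes "is_pinv A X" "c \<noteq> 0"
  shows "is_pinv (c *\<^sub>R A) (inverse c *\<^sub>R X)"
  using assms by (simp add: is_pinv_def matrix_scalar_ac flip: scalar_matrix_assoc)

lemma pinv_restrict_mat_scaleR:
  assumes "pos_def A" "c \<noteq> 0"
  shows "pinv (restrict_mat (c *\<^sub>R A) S) = inverse c *\<^sub>R pinv (restrict_mat A S)"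
proof -
  obtain X where X: "is_pinv (restrict_mat A S) X"
    using unit_padding_inverse[OF assms(1)] pinv_restrict_mat(1) by metis
  have "restrict_mat (c *\<^sub>R A) S = c *\<^sub>R restrict_mat A S"
    by (simp add: restrict_mat_def vec_eq_iff)
  then show ?thesis
    using pinv_eqI[OF is_pinv_scaleR[OF X assms(2)]] pinv_eqI[OF X] by simp
qed

section \<open>The expected pseudoinverse under a determinantal point process\<close>

text \<open>
  For \<open>k \<in> S\<close> the column operation takes place inside the submatrix and the formula is
  \<open>det_add_to_column\<close> for the padded matrix. For \<open>k \<notin> S\<close> the submatrix does not change, and row \<open>k\<close>
  of the pseudoinverse is zero.
\<close>

lemma principal_minor_add_to_column:
  fixes A :: "real ^ 'n ^ 'n"
  assumes "pos_def A"
  shows "principal_minor (add_to_column A k u) S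
    = principal_minor A S * (1 + (pinv (restrict_mat A S) *v u) $ k)"
proof -
  let ?J = "coord_proj S"
  obtain X where X: "unit_padding A S ** X = mat 1" "X ** unit_padding A S = mat 1"
    using unit_padding_inverse[OF assms] by metis
  note pinv = pinv_restrict_mat[OF X]
  have minor: "principal_minor C S = det (unit_padding C S)" for C :: "real ^ 'n ^ 'n"
    by (simp add: principal_minor_eq_det unit_padding_def)
  have u: "pinv (restrict_mat A S) *v u = X *v (?J *v u)"
    "pinv (restrict_mat A S) *v u = ?J *v (X *v u)"
    using pinv_eqI[OF pinv(1)] pinv(2) by (simp_all add: matrix_vector_mul_assoc)
  show ?thesis
  proof (cases "k \<in> S")
    case True
    then have "unit_padding (add_to_column A k u) S = add_to_column (unit_padding A S) k (?J *v u)"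
      by (auto simp: vec_eq_iff unit_padding_def add_to_column_def coord_proj_mult_vec)
    then show ?thesis
      using det_add_to_column[OF X(1)] by (simp add: minor u(1))
  next
    case False
    then have "unit_padding (add_to_column A k u) S = unit_padding A S"
      by (auto simp: vec_eq_iff unit_padding_def add_to_column_def)
    then show ?thesis
      using False by (simp add: minor u(2) coord_proj_mult_vec)
  qed
qed

text \<open>
  The matrix form of the classical expansion of the adjugate of \<open>I + A\<close>: expand
  \<open>det (I + A + u e\<^sub>k\<^sup>T)\<close> once by Cramer's rule and once over principal minors, and compare the parts
  that are linear in \<open>u\<close>.
\<close>

lemma sum_principal_minor_pinv:
  fixes A :: "real ^ 'n ^ 'n"
  assumes "pos_def A" "(mat 1 + A) ** X = mat 1"
  shows "(\<Sum>S\<in>UNIV. principal_minor A S *\<^sub>R pinv (restrict_mat A S)) = det (mat 1 + A) *\<^sub>R X"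
proof -
  have "(\<Sum>S\<in>UNIV. principal_minor A S * (pinv (restrict_mat A S) *v u) $ k)
      = det (mat 1 + A) * (X *v u) $ k" for k u
  proof -
    \<comment> \<open>The sum over principal minors applies to any matrix, so the perturbation may be absorbed into \<open>A\<close>.\<close>
    have "add_to_column (mat 1 + A) k u = mat 1 + add_to_column A k u"
      by (simp add: add_to_column_def vec_eq_iff)
    then have "det (mat 1 + A) * (1 + (X *v u) $ k)
        = (\<Sum>S\<in>UNIV. principal_minor (add_to_column A k u) S)"
      using det_add_to_column[OF assms(2), of k u] by (simp add: det_mat_1_plus)
    also have "\<dots> = (\<Sum>S\<in>UNIV. principal_minor A S * (1 + (pinv (restrict_mat A S) *v u) $ k))"
      by (simp add: principal_minor_add_to_column[OF assms(1)])
    also have "\<dots> = det (mat 1 + A)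
        + (\<Sum>S\<in>UNIV. principal_minor A S * (pinv (restrict_mat A S) *v u) $ k)"
      by (simp add: distrib_left sum.distrib det_mat_1_plus)
    finally show ?thesis
      by (simp add: distrib_left)
  qed
  \<comment> \<open>Unit vectors \<open>u\<close> pick out the individual matrix entries.\<close>
  from this[of "axis _ 1"] show ?thesis
    by (simp add: vec_eq_iff matrix_vector_mult_basis column_def)
qed

text \<open>
  The normalising constant of the point process is \<open>det (I + A)\<close>, the factor in front of \<open>X\<close> in the
  preceding identity.
\<close>

lemma expectation_pinv_DPP:
  fixes A :: "real ^ 'n ^ 'n"
  assumes "pos_def A" "(mat 1 + A) ** X = mat 1"
  shows "(\<integral>S. pinv (restrict_mat A S) \<partial>measure_pmf (DPP A)) = X"
proof -
  have "det (mat 1 + A) \<noteq> 0"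
    using assms(2) by (auto simp flip: invertible_det_nz simp: invertible_right_inverse)
  have "(\<integral>S. pinv (restrict_mat A S) \<partial>measure_pmf (DPP A))
      = (\<Sum>S\<in>UNIV. pmf (DPP A) S *\<^sub>R pinv (restrict_mat A S))"
    by (rule integral_measure_pmf) auto
  also have "\<dots> = inverse (det (mat 1 + A)) *\<^sub>R
      (\<Sum>S\<in>UNIV. principal_minor A S *\<^sub>R pinv (restrict_mat A S))"
    by (simp add: pmf_DPP[OF pos_def_imp_psd[OF assms(1)]] scaleR_sum_right divide_inverse_commute
        flip: det_mat_1_plus)
  also have "\<dots> = X"
    using \<open>det (mat 1 + A) \<noteq> 0\<close> by (simp add: sum_principal_minor_pinv[OF assms])
  finally show ?thesis .
qed

text \<open>
  Rescaling by \<open>\<alpha>\<close> turns \<open>(I + M / \<alpha>)\<^sup>-\<^sup>1\<close> into \<open>\<alpha> (M + \<alpha> I)\<^sup>-\<^sup>1\<close>, and the factor \<open>\<alpha>\<close> cancels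
  against that of the pseudoinverse.
\<close>

lemma expectation_pinv_DPP_scaled:
  fixes M :: "real ^ 'n ^ 'n"
  assumes "pos_def M" "0 < \<alpha>" "(M + \<alpha> *\<^sub>R mat 1) ** X = mat 1"
  shows "(\<integral>T. pinv (restrict_mat M T) \<partial>measure_pmf (DPP ((1 / \<alpha>) *\<^sub>R M))) = X"
proof -
  let ?A = "(1 / \<alpha>) *\<^sub>R M"
  have A: "pos_def ?A"
    using assms(1,2) by (intro pos_def_scaleR) auto
  have "mat 1 + ?A = (1 / \<alpha>) *\<^sub>R (M + \<alpha> *\<^sub>R mat 1)"
    using assms(2) by (simp add: scaleR_add_right)
  then have inverse: "(mat 1 + ?A) ** (\<alpha> *\<^sub>R X) = mat 1"
    using assms(2,3) by (simp add: matrix_scalar_ac flip: scalar_matrix_assoc)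
  have "pinv (restrict_mat M T) = inverse \<alpha> *\<^sub>R pinv (restrict_mat ?A T)" for T
    using pinv_restrict_mat_scaleR[OF A, of \<alpha> T] assms(2) by simp
  then have "(\<integral>T. pinv (restrict_mat M T) \<partial>measure_pmf (DPP ?A))
      = inverse \<alpha> *\<^sub>R (\<integral>T. pinv (restrict_mat ?A T) \<partial>measure_pmf (DPP ?A))"
    by (simp add: integrable_measure_pmf_finite)
  also have "\<dots> = X"
    using assms(2) by (simp add: expectation_pinv_DPP[OF A inverse])
  finally show ?thesis .
qed

section \<open>The resolvent and its smallest eigenvalue\<close>

lemma pos_def_shift_inverse:
  fixes M :: "real ^ 'n ^ 'n"
  assumes "pos_def M" "0 < \<alpha>"
  obtains X where "(M + \<alpha> *\<^sub>R mat 1) ** X = mat 1" "X ** (M + \<alpha> *\<^sub>R mat 1) = mat 1"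
proof -
  have "x = 0" if "(M + \<alpha> *\<^sub>R mat 1) *v x = 0" for x
  proof (rule ccontr)
    assume "x \<noteq> 0"
    then have "0 < x \<bullet> (M *v x) + \<alpha> * (x \<bullet> x)"
      using assms unfolding pos_def_def by (intro add_pos_pos mult_pos_pos) auto
    also have "\<dots> = x \<bullet> ((M + \<alpha> *\<^sub>R mat 1) *v x)"
      by (simp add: matrix_vector_mult_add_rdistrib inner_add_right flip: scaleR_matrix_vector_assoc)
    finally show False
      using that by simp
  qed
  then show thesis
    using that matrix_left_invertible_ker matrix_left_right_inverse by metis
qed

lemma matrix_add_rdistrib:
  fixes A B :: "real ^ 'n ^ 'm" and C :: "real ^ 'k ^ 'n"
  shows "(A + B) ** C = A ** C + B ** C"
  by (simp add: matrix_matrix_mult_def vec_eq_iff distrib_right sum.distrib)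

lemma commute_imp_commute_inverse:
  fixes R :: "real ^ 'n ^ 'n"
  assumes "R ** B = B ** R" "B ** X = mat 1" "X ** B = mat 1"
  shows "R ** X = X ** R"
proof -
  have "R ** X = X ** (B ** R) ** X"
    by (simp add: matrix_mul_assoc assms(3))
  also have "\<dots> = X ** R"
    by (simp add: assms(1)[symmetric] assms(2) flip: matrix_mul_assoc)
  finally show ?thesis .
qed

lemma msqrt_resolvent_msqrt:
  fixes M :: "real ^ 'n ^ 'n"
  assumes M: "psd M"
    and X: "(M + \<alpha> *\<^sub>R mat 1) ** X = mat 1" "X ** (M + \<alpha> *\<^sub>R mat 1) = mat 1"
  shows "msqrt M ** X ** msqrt M = M ** X"
proof -
  let ?R = "msqrt M"
  have "?R ** M = M ** ?R"
    by (metis msqrt(2)[OF M] matrix_mul_assoc)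
  then have "?R ** (M + \<alpha> *\<^sub>R mat 1) = (M + \<alpha> *\<^sub>R mat 1) ** ?R"
    by (simp add: matrix_add_ldistrib matrix_add_rdistrib matrix_scalar_ac
        flip: scalar_matrix_assoc)
  then have "?R ** X = X ** ?R"
    using X by (rule commute_imp_commute_inverse)
  then have "?R ** X ** ?R = ?R ** ?R ** X"
    by (metis matrix_mul_assoc)
  then show ?thesis
    by (simp add: msqrt(2)[OF M])
qed

text \<open>
  If \<open>M v = l v\<close> then \<open>v\<close> is also an eigenvector of the resolvent \<open>X\<close>. Conversely, an eigenvector
  \<open>v\<close> of \<open>M X\<close> need not be compared with \<open>M\<close> directly: the vector \<open>w = X v\<close> satisfies
  \<open>M w = c (M w + \<alpha> w)\<close>, so it is an eigenvector of \<open>M\<close> with eigenvalue \<open>c \<alpha> / (1 - c)\<close>, the preimage of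
  \<open>c\<close> under \<open>l \<mapsto> l / (l + \<alpha>)\<close>.
\<close>

lemma eigenvalues_resolvent:
  fixes M :: "real ^ 'n ^ 'n"
  assumes pd: "pos_def M" and \<alpha>: "0 < \<alpha>" and X: "(M + \<alpha> *\<^sub>R mat 1) ** X = mat 1"
  shows "eigenvalues (M ** X) = (\<lambda>c. c / (c + \<alpha>)) ` eigenvalues M"
proof (intro set_eqI iffI)
  have shift: "(M + \<alpha> *\<^sub>R mat 1) *v x = M *v x + \<alpha> *\<^sub>R x" for x
    by (simp add: matrix_vector_mult_add_rdistrib flip: scaleR_matrix_vector_assoc)
  have X': "X ** (M + \<alpha> *\<^sub>R mat 1) = mat 1"
    using X matrix_left_right_inverse by blast
  fix c
  {
    assume "c \<in> (\<lambda>c. c / (c + \<alpha>)) ` eigenvalues M"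
    then obtain l v where v: "v \<noteq> 0" "M *v v = l *\<^sub>R v" and c: "c = l / (l + \<alpha>)"
      by (auto simp: eigenvalues_def)
    have "0 < l"
      using pos_def_eigenvalue_pos[OF pd] v by (auto simp: eigenvalues_def)
    have "(l + \<alpha>) *\<^sub>R (X *v v) = X *v ((M + \<alpha> *\<^sub>R mat 1) *v v)"
      by (simp add: shift v matrix_vector_mult_scaleR flip: scaleR_add_left)
    also have "\<dots> = v"
      by (simp add: matrix_vector_mul_assoc X')
    finally have "X *v v = inverse (l + \<alpha>) *\<^sub>R v"
      using \<open>0 < l\<close> \<alpha> by (metis add_pos_pos less_irrefl scaleR_left_imp_eq scaleR_scaleR
          right_inverse scaleR_one)
    then have "(M ** X) *v v = c *\<^sub>R v"
      by (simp add: v c divide_inverse_commute matrix_vector_mult_scaleR flip: matrix_vector_mul_assoc)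
    then show "c \<in> eigenvalues (M ** X)"
      using v by (auto simp: eigenvalues_def)
  next
    assume "c \<in> eigenvalues (M ** X)"
    then obtain v where v: "v \<noteq> 0" "(M ** X) *v v = c *\<^sub>R v"
      by (auto simp: eigenvalues_def)
    define w where "w = X *v v"
    have vw: "v = M *v w + \<alpha> *\<^sub>R w"
      unfolding w_def shift[symmetric] by (simp add: matrix_vector_mul_assoc X)
    then have "w \<noteq> 0"
      using v by auto
    have "M *v w = c *\<^sub>R (M *v w + \<alpha> *\<^sub>R w)"
      using v(2) unfolding vw[symmetric] by (simp add: w_def matrix_vector_mul_assoc)
    then have w: "(1 - c) *\<^sub>R (M *v w) = (c * \<alpha>) *\<^sub>R w"
      by (simp add: algebra_simps)
    then have "c \<noteq> 1"
      using \<open>w \<noteq> 0\<close> \<alpha> by auto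
    have "M *v w = inverse (1 - c) *\<^sub>R ((1 - c) *\<^sub>R (M *v w))"
      using \<open>c \<noteq> 1\<close> by simp
    also have "\<dots> = (c * \<alpha> / (1 - c)) *\<^sub>R w"
      by (simp add: w divide_inverse_commute)
    finally have "c * \<alpha> / (1 - c) \<in> eigenvalues M"
      using \<open>w \<noteq> 0\<close> by (auto simp: eigenvalues_def)
    moreover have "c = (c * \<alpha> / (1 - c)) / (c * \<alpha> / (1 - c) + \<alpha>)"
    proof -
      have "c * \<alpha> / (1 - c) + \<alpha> = \<alpha> / (1 - c)"
        using \<open>c \<noteq> 1\<close> by (simp add: field_simps)
      then show ?thesis
        using \<open>c \<noteq> 1\<close> \<alpha> by simp
    qed
    ultimately show "c \<in> (\<lambda>c. c / (c + \<alpha>)) ` eigenvalues M"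
      by (rule rev_image_eqI)
  }
qed

lemma lambda_min_resolvent:
  fixes M :: "real ^ 'n ^ 'n"
  assumes "pos_def M" "0 < \<alpha>" "(M + \<alpha> *\<^sub>R mat 1) ** X = mat 1"
  shows "lambda_min (M ** X) = lambda_min M / (lambda_min M + \<alpha>)"
  unfolding lambda_min_def eigenvalues_resolvent[OF assms]
proof (rule Min_eqI)
  have eig: "finite (eigenvalues M)" "eigenvalues M \<noteq> {}"
    using symmetric_eigenvalues assms(1) by (auto simp: pos_def_def)
  then have min: "Min (eigenvalues M) \<in> eigenvalues M"
    by (rule Min_in)
  show "finite ((\<lambda>c. c / (c + \<alpha>)) ` eigenvalues M)"
    using eig by simp
  show "Min (eigenvalues M) / (Min (eigenvalues M) + \<alpha>) \<in> (\<lambda>c. c / (c + \<alpha>)) ` eigenvalues M"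
    using min by (rule imageI)
  fix y assume "y \<in> (\<lambda>c. c / (c + \<alpha>)) ` eigenvalues M"
  then obtain c where c: "c \<in> eigenvalues M" "y = c / (c + \<alpha>)"
    by auto
  have pos: "0 < Min (eigenvalues M)" and le: "Min (eigenvalues M) \<le> c"
    using pos_def_eigenvalue_pos[OF assms(1) min] c(1) eig(1) by auto
  then show "Min (eigenvalues M) / (Min (eigenvalues M) + \<alpha>) \<le> y"
    unfolding c(2) using assms(2) by (simp add: field_simps)
qed

section \<open>The convergence rate\<close>

theorem theorem2:
  fixes f :: "real ^ 'n \<Rightarrow> real" and grad_f :: "real ^ 'n \<Rightarrow> real ^ 'n"
    and M :: "real ^ 'n ^ 'n" and \<kappa> \<alpha> :: real
    and P :: "'w measure" and S :: "'w \<Rightarrow> 'n set"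
  assumes "convex_on UNIV f"
    and "\<And>x. GDERIV f x :> grad_f x"
    and "pos_def M"
    and "\<And>x h. f (x + h) \<le> f x + grad_f x \<bullet> h + 1 / 2 * (h \<bullet> (M *v h))"
    and "\<kappa> > 0"
    and "\<And>x h. f x + grad_f x \<bullet> h + \<kappa> / 2 * (h \<bullet> (M *v h)) \<le> f (x + h)"
    and "\<alpha> > 0"
    and "prob_space P"
    and "S \<in> P \<rightarrow>\<^sub>M count_space UNIV"
    and "distr P (count_space UNIV) S = measure_pmf (DPP ((1 / \<alpha>) *\<^sub>R M))"
  shows "rate_sigma \<kappa> M P S = \<kappa> * (lambda_min M / (lambda_min M + \<alpha>))"
proof -
  have M: "pos_def M" and \<alpha>: "0 < \<alpha>"
    by fact+
  obtain X where X: "(M + \<alpha> *\<^sub>R mat 1) ** X = mat 1" "X ** (M + \<alpha> *\<^sub>R mat 1) = mat 1"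
    using pos_def_shift_inverse[OF M \<alpha>] by metis
  have "(\<integral>\<omega>. pinv (restrict_mat M (S \<omega>)) \<partial>P)
      = (\<integral>T. pinv (restrict_mat M T) \<partial>distr P (count_space UNIV) S)"
    using assms(9) by (intro integral_distr[symmetric]) auto
  also have "\<dots> = X"
    unfolding assms(10) using expectation_pinv_DPP_scaled[OF M \<alpha> X(1)] .
  finally have "rate_sigma \<kappa> M P S = \<kappa> * lambda_min (msqrt M ** X ** msqrt M)"
    by (simp add: rate_sigma_def)
  then show ?thesis
    by (simp add: msqrt_resolvent_msqrt[OF pos_def_imp_psd[OF M] X] lambda_min_resolvent[OF M \<alpha> X(1)])
qed

end
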